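(* Let $f$ be a finitary Boolean function. Then $\delta_{B_mf}\to\delta_f$ as $m\to\infty$.
   Context: Let $\Omega=\{-1,1\}$ and $\Omega^\infty=\{-1,1\}^{\mathbb N}$ with the uniform product probability measure; $\omega$ denotes a uniformly random element. A Boolean function is a measurable map $f:\Omega^\infty\to\Omega$. A set $W\subseteq\mathbb N$ is a witness set for $f$ at $\omega$ if there is an event $A$ with $\mathbb P(A)=1$ such that for all $\tilde\omega\in A$: if $\tilde\omega_i=\omega_i$ for all $i\in W$ then $f(\tilde\omega)=f(\omega)$. $f$ is finitary if almost surely a finite witness set exists; then $W(f)(\omega)$ denotes the least finite witness set in the order: smaller maximum first, then smaller cardinality, then lexicographic. $B_mf=\mathbf 1_{\{W(f)\subseteq[m]\}}f-\mathbf 1_{\{W(f)\not\subseteq[m]\}}$. A (randomised) algorithm $A$ for a finitary $g$ queries bits of $\omega$ one at a time, each next index chosen as a function of the bits queried so far and independent auxiliary randomness, and stops once the set of queried bits is a witness set for $g$ at $\omega$; it is required to query almost surely only finitely many bits. $W(A)$ is the (random) set of queried bits. The revealment of $g$ is $\delta_g=\inf_A\sup_i\mathbb P(i\in W(A))$, the infimum over all such algorithms for $g$. *)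

theory Defs
  imports "HOL-Probability.Probability"
begin

definition Omega :: "(nat \<Rightarrow> int) measure" where
  "Omega = PiM UNIV (\<lambda>_. measure_pmf (pmf_of_set {-1, 1}))"

definition Aux :: "real measure" where
  "Aux = uniform_measure lborel {0..1}"

definition boolean_function :: "((nat \<Rightarrow> int) \<Rightarrow> int) \<Rightarrow> bool" where
  "boolean_function f \<longleftrightarrow> f \<in> measurable Omega (count_space UNIV) \<and>
     (\<forall>\<omega>\<in>space Omega. f \<omega> \<in> {-1, 1})"

definition witness_set :: "((nat \<Rightarrow> int) \<Rightarrow> int) \<Rightarrow> (nat \<Rightarrow> int) \<Rightarrow> nat set \<Rightarrow> bool" where
  "witness_set f \<omega> W \<longleftrightarrow> (\<exists>A \<in> sets Omega. measure Omega A = 1 \<and>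
     (\<forall>\<omega>' \<in> A. (\<forall>i\<in>W. \<omega>' i = \<omega> i) \<longrightarrow> f \<omega>' = f \<omega>))"

definition finitary :: "((nat \<Rightarrow> int) \<Rightarrow> int) \<Rightarrow> bool" where
  "finitary f \<longleftrightarrow> boolean_function f \<and>
     (AE \<omega> in Omega. \<exists>W. finite W \<and> witness_set f \<omega> W)"

definition max_key :: "nat set \<Rightarrow> nat" where
  "max_key W = (if W = {} then 0 else Suc (Max W))"

definition wit_less :: "nat set \<Rightarrow> nat set \<Rightarrow> bool" where
  "wit_less V W \<longleftrightarrow> max_key V < max_key W \<or>
     (max_key V = max_key W \<and> (card V < card W \<or>
       (card V = card W \<and>
        (sorted_list_of_set V, sorted_list_of_set W) \<in> lexord {(a, b). a < b})))"

definition least_witness :: "((nat \<Rightarrow> int) \<Rightarrow> int) \<Rightarrow> (nat \<Rightarrow> int) \<Rightarrow> nat set" where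
  "least_witness f \<omega> = (THE W. finite W \<and> witness_set f \<omega> W \<and>
     (\<forall>V. finite V \<and> witness_set f \<omega> V \<and> V \<noteq> W \<longrightarrow> wit_less W V))"

definition Bm :: "nat \<Rightarrow> ((nat \<Rightarrow> int) \<Rightarrow> int) \<Rightarrow> (nat \<Rightarrow> int) \<Rightarrow> int" where
  "Bm m f \<omega> = (if least_witness f \<omega> \<subseteq> {..<m} then f \<omega> else -1)"

text \<open>A randomised algorithm: the next index is a function of the auxiliary randomness u
  and the history of (index, value) pairs queried so far.\<close>
primrec qhist :: "(real \<Rightarrow> (nat \<times> int) list \<Rightarrow> nat) \<Rightarrow> (nat \<Rightarrow> int) \<Rightarrow> real \<Rightarrow> nat
    \<Rightarrow> (nat \<times> int) list" where
  "qhist nx \<omega> u 0 = []"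
| "qhist nx \<omega> u (Suc n) =
     (let i = nx u (qhist nx \<omega> u n) in qhist nx \<omega> u n @ [(i, \<omega> i)])"

definition queried :: "(real \<Rightarrow> (nat \<times> int) list \<Rightarrow> nat) \<Rightarrow> (nat \<Rightarrow> int) \<Rightarrow> real \<Rightarrow> nat \<Rightarrow> nat set" where
  "queried nx \<omega> u n = fst ` set (qhist nx \<omega> u n)"

definition algorithm_for :: "((nat \<Rightarrow> int) \<Rightarrow> int) \<Rightarrow> (real \<Rightarrow> (nat \<times> int) list \<Rightarrow> nat) \<Rightarrow> bool" where
  "algorithm_for g nx \<longleftrightarrow>
     (\<forall>h. (\<lambda>u. nx u h) \<in> measurable Aux (count_space UNIV)) \<and>
     (AE z in Omega \<Otimes>\<^sub>M Aux. \<exists>n. witness_set g (fst z) (queried nx (fst z) (snd z) n))"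

definition stop_time :: "((nat \<Rightarrow> int) \<Rightarrow> int) \<Rightarrow> (real \<Rightarrow> (nat \<times> int) list \<Rightarrow> nat) \<Rightarrow> (nat \<Rightarrow> int) \<Rightarrow> real \<Rightarrow> nat" where
  "stop_time g nx \<omega> u = (LEAST n. witness_set g \<omega> (queried nx \<omega> u n))"

definition alg_W :: "((nat \<Rightarrow> int) \<Rightarrow> int) \<Rightarrow> (real \<Rightarrow> (nat \<times> int) list \<Rightarrow> nat) \<Rightarrow> (nat \<Rightarrow> int) \<Rightarrow> real \<Rightarrow> nat set" where
  "alg_W g nx \<omega> u = queried nx \<omega> u (stop_time g nx \<omega> u)"

definition revealment :: "((nat \<Rightarrow> int) \<Rightarrow> int) \<Rightarrow> real" where
  "revealment g = (INF nx \<in> {nx. algorithm_for g nx}.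
     SUP i. measure (Omega \<Otimes>\<^sub>M Aux) {z \<in> space (Omega \<Otimes>\<^sub>M Aux). i \<in> alg_W g nx (fst z) (snd z)})"

end

theory Submission
  imports Defs
begin

text \<open>Write \<open>[m]\<close> for the first \<open>m\<close> bits. Almost surely \<open>B\<^sub>m f\<close> is \<open>f\<close> if \<open>[m]\<close> is a witness set
  for \<open>f\<close> and \<open>-1\<close> otherwise.

  From \<open>f\<close> to \<open>B\<^sub>m f\<close>: run an algorithm for \<open>f\<close> until it leaves \<open>[m]\<close>, which has small probability,
  and then query everything. A witness set for \<open>f\<close> inside \<open>[m]\<close> is one for \<open>B\<^sub>m f\<close>.

  From \<open>B\<^sub>m f\<close> to \<open>f\<close>: a witness set for \<open>B\<^sub>m f = -1\<close> need not be one for \<open>f\<close>, so one must also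
  certify that \<open>[m]\<close> is a witness set. This costs almost nothing. Overwriting finitely many bits
  preserves null sets, so for every \<open>n\<close> the bits in \<open>{n..<k}\<close> certify, with probability tending to
  \<open>1\<close> as \<open>k\<close> grows, that \<open>[k]\<close> is a witness set whatever the first \<open>n\<close> bits are. Take \<open>K\<close> consecutive
  such windows, query a random one of them, and then run the algorithm for \<open>B\<^sub>m f\<close>: each bit is
  queried because of the window with probability at most \<open>1 / K\<close>.\<close>

section \<open>The probability spaces and events that depend on finitely many bits\<close>

lemma space_Omega [simp]: "space Omega = UNIV"
  by (simp add: Omega_def space_PiM)

interpretation Omega: prob_space Omega
  unfolding Omega_def by (intro prob_space_PiM prob_space_measure_pmf)

lemma space_Aux [simp]: "space Aux = UNIV"
  by (simp add: Aux_def)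

lemma sets_Aux [measurable_cong]: "sets Aux = sets borel"
  by (simp add: Aux_def)

interpretation Aux: prob_space Aux
  unfolding Aux_def by (rule prob_space_uniform_measure) auto

interpretation OA: pair_prob_space Omega Aux ..

lemma measurable_coordinate [measurable]: "(\<lambda>\<omega>. \<omega> i) \<in> measurable Omega (count_space UNIV)"
proof -
  have "(\<lambda>\<omega>. \<omega> i) \<in> measurable Omega (measure_pmf (pmf_of_set {-1, 1}))"
    unfolding Omega_def by (rule measurable_component_singleton) simp
  then show ?thesis by simp
qed

lemma AE_Omega_sign: "AE \<omega> in Omega. \<forall>i. \<omega> i \<in> {-1, 1}"
proof -
  have "AE \<omega> in Omega. \<omega> i \<in> {-1, 1}" for i
    unfolding Omega_def
    by (rule AE_PiM_component) (auto intro: prob_space_measure_pmf simp: AE_measure_pmf_iff)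
  then show ?thesis by (simp add: AE_all_countable)
qed

text \<open>The space consists of all integer sequences, not only of sign sequences, so there are
  infinitely many patterns on \<open>F\<close>; but they are countably many, and the event is a
  countable union of cylinders.\<close>

lemma pred_finite_coordinates:
  assumes "finite F" and dep: "\<And>\<omega> \<omega>'. (\<forall>i\<in>F. \<omega> i = \<omega>' i) \<Longrightarrow> Q \<omega> \<Longrightarrow> Q \<omega>'"
  shows "Measurable.pred Omega Q"
proof -
  define X where "X = {p \<in> PiE F (\<lambda>_. UNIV). Q p}"
  have cnt: "countable X"
    using countable_PiE[of F "\<lambda>_. UNIV :: int set"] assms(1)
    by (intro countable_subset[of X "PiE F (\<lambda>_. UNIV)"]) (auto simp: X_def)
  have "Q \<omega> \<longleftrightarrow> (\<exists>p\<in>X. \<forall>i\<in>F. \<omega> i = p i)" for \<omega>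
  proof
    assume "Q \<omega>"
    then have "Q (restrict \<omega> F)" by (rule dep[rotated]) simp
    then show "\<exists>p\<in>X. \<forall>i\<in>F. \<omega> i = p i" by (intro bexI[of _ "restrict \<omega> F"]) (auto simp: X_def)
  next
    assume "\<exists>p\<in>X. \<forall>i\<in>F. \<omega> i = p i"
    then obtain p where "Q p" "\<forall>i\<in>F. p i = \<omega> i" by (auto simp: X_def)
    then show "Q \<omega>" by (rule dep[rotated])
  qed
  then have "{\<omega> \<in> space Omega. Q \<omega>} = (\<Union>p\<in>X. {\<omega> \<in> space Omega. \<forall>i\<in>F. \<omega> i = p i})"
    by auto
  moreover have "{\<omega> \<in> space Omega. \<forall>i\<in>F. \<omega> i = p i} \<in> sets Omega" for p
    using assms(1) by measurable
  ultimately show ?thesis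
    unfolding pred_def by (simp only:) (rule sets.countable_UN'[OF cnt], auto)
qed

section \<open>Overwriting finitely many bits preserves null sets\<close>

text \<open>Resampling bit \<open>i\<close> independently leaves the law unchanged. By Fubini the
  property then holds for almost every resampled value, and both signs have positive mass.\<close>

lemma AE_set_coordinate:
  assumes "AE \<omega> in Omega. P \<omega>" and v: "v \<in> {-1, 1}"
  shows "AE \<omega> in Omega. P (fun_upd \<omega> i v)"
proof -
  let ?p = "measure_pmf (pmf_of_set {-1, 1 :: int})"
  interpret pp: pair_sigma_finite ?p Omega
    by (intro pair_sigma_finite.intro prob_space_imp_sigma_finite prob_space_measure_pmf
        Omega.prob_space_axioms)
  have eq: "distr (?p \<Otimes>\<^sub>M Omega) Omega (\<lambda>(x, X). fun_upd X i x) = Omega"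
    using distr_pair_PiM_eq_PiM[of UNIV "\<lambda>_. ?p" i] unfolding Omega_def
    by (simp add: prob_space_measure_pmf)
  have m: "(\<lambda>(x, X). fun_upd X i x) \<in> measurable (?p \<Otimes>\<^sub>M Omega) Omega"
    unfolding Omega_def split_beta
    by (rule measurable_fun_upd[where J = UNIV]) (auto intro: measurable_fst measurable_snd)
  have "AE z in ?p \<Otimes>\<^sub>M Omega. P ((\<lambda>(x, X). fun_upd X i x) z)"
    using assms(1) by (intro AE_distrD[OF m]) (simp only: eq)
  from pp.AE_pair[OF this] show ?thesis
    using v by (auto simp: AE_measure_pmf_iff)
qed

definition overwrite :: "nat \<Rightarrow> (nat \<Rightarrow> int) \<Rightarrow> (nat \<Rightarrow> int) \<Rightarrow> nat \<Rightarrow> int" where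
  "overwrite n x \<omega> = (\<lambda>i. if i < n then x i else \<omega> i)"

lemma AE_overwrite:
  assumes "AE \<omega> in Omega. P \<omega>" and "\<forall>i<n. x i \<in> {-1, 1}"
  shows "AE \<omega> in Omega. P (overwrite n x \<omega>)"
  using assms(2)
proof (induction n)
  case 0
  then show ?case using assms(1) by (simp add: overwrite_def)
next
  case (Suc n)
  have "overwrite (Suc n) x \<omega> = overwrite n x (fun_upd \<omega> n (x n))" for \<omega>
    by (auto simp: overwrite_def less_Suc_eq)
  then show ?case
    using AE_set_coordinate[of "\<lambda>\<omega>. P (overwrite n x \<omega>)" "x n" n] Suc by simp
qed

section \<open>Witness sets in terms of cylinders\<close>

text \<open>In contrast to \<open>witness_set\<close>, which refers to \<open>f \<omega>\<close> and
  hence to all bits, this depends on \<open>\<omega>\<close> only through its bits in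
  \<open>W\<close>. On a null cylinder every \<open>c\<close> is decided.\<close>

definition decided :: "((nat \<Rightarrow> int) \<Rightarrow> int) \<Rightarrow> (nat \<Rightarrow> int) \<Rightarrow> nat set \<Rightarrow> int \<Rightarrow> bool" where
  "decided f \<omega> W c \<longleftrightarrow> (AE \<omega>' in Omega. (\<forall>i\<in>W. \<omega>' i = \<omega> i) \<longrightarrow> f \<omega>' = c)"

lemma witness_set_iff_decided: "witness_set f \<omega> W \<longleftrightarrow> decided f \<omega> W (f \<omega>)"
proof
  assume "witness_set f \<omega> W"
  then obtain A where A: "A \<in> sets Omega" "measure Omega A = 1"
    "\<forall>\<omega>' \<in> A. (\<forall>i\<in>W. \<omega>' i = \<omega> i) \<longrightarrow> f \<omega>' = f \<omega>"
    unfolding witness_set_def by auto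
  then have "AE \<omega>' in Omega. \<omega>' \<in> A" by (simp add: Omega.prob_eq_1)
  then show "decided f \<omega> W (f \<omega>)" unfolding decided_def by eventually_elim (use A in auto)
next
  assume "decided f \<omega> W (f \<omega>)"
  then obtain N where N: "N \<in> null_sets Omega"
    "{\<omega>' \<in> space Omega. \<not> ((\<forall>i\<in>W. \<omega>' i = \<omega> i) \<longrightarrow> f \<omega>' = f \<omega>)} \<subseteq> N"
    unfolding decided_def eventually_ae_filter by auto
  then have "measure Omega (space Omega - N) = 1"
    by (subst Omega.prob_compl) (auto simp: null_sets_def measure_def)
  moreover have "space Omega - N \<in> sets Omega" using N(1) by (intro sets.compl_sets) (rule null_setsD2)
  moreover have "\<forall>\<omega>'\<in>space Omega - N. (\<forall>i\<in>W. \<omega>' i = \<omega> i) \<longrightarrow> f \<omega>' = f \<omega>"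
    using N(2) by blast
  ultimately show "witness_set f \<omega> W" unfolding witness_set_def by blast
qed

lemma decided_cong:
  assumes "\<forall>i\<in>W. \<omega> i = \<omega>' i"
  shows "decided f \<omega> W c \<longleftrightarrow> decided f \<omega>' W c"
  using assms unfolding decided_def by simp

lemma decided_mono:
  assumes "decided f \<omega> V c" "V \<subseteq> W"
  shows "decided f \<omega> W c"
  using assms(1) unfolding decided_def by eventually_elim (use assms(2) in auto)

lemma witness_set_mono: "witness_set f \<omega> V \<Longrightarrow> V \<subseteq> W \<Longrightarrow> witness_set f \<omega> W"
  unfolding witness_set_iff_decided by (rule decided_mono)

text \<open>Only countably many cylinders are involved, so outside a null set a decided value is the
  actual value of the function.\<close>
lemma AE_decided_imp_value:
  "AE \<omega> in Omega. \<forall>W c. finite W \<longrightarrow> decided f \<omega> W c \<longrightarrow> f \<omega> = c"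
proof -
  have "AE \<omega> in Omega. \<forall>W\<in>Collect finite. \<forall>p\<in>PiE W (\<lambda>_. UNIV). \<forall>c.
    decided f p W c \<longrightarrow> (\<forall>i\<in>W. \<omega> i = p i) \<longrightarrow> f \<omega> = c"
  proof (subst AE_ball_countable[OF countable_Collect_finite], rule ballI)
    fix W :: "nat set" assume "W \<in> Collect finite"
    then have cnt: "countable (PiE W (\<lambda>_. UNIV :: int set))" by (simp add: countable_PiE)
    have "AE \<omega> in Omega. decided f p W c \<longrightarrow> (\<forall>i\<in>W. \<omega> i = p i) \<longrightarrow> f \<omega> = c" for p c
      by (cases "decided f p W c") (simp_all add: decided_def)
    then show "AE \<omega> in Omega. \<forall>p\<in>PiE W (\<lambda>_. UNIV). \<forall>c.
        decided f p W c \<longrightarrow> (\<forall>i\<in>W. \<omega> i = p i) \<longrightarrow> f \<omega> = c"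
      unfolding AE_ball_countable[OF cnt] AE_all_countable by simp
  qed
  then show ?thesis
  proof eventually_elim
    case (elim \<omega>)
    show ?case
    proof (intro allI impI)
      fix W c assume "finite W" "decided f \<omega> W c"
      moreover have "decided f (restrict \<omega> W) W c"
        using \<open>decided f \<omega> W c\<close> by (subst decided_cong[of W _ \<omega>]) auto
      moreover have "restrict \<omega> W \<in> PiE W (\<lambda>_. UNIV)" "\<forall>i\<in>W. \<omega> i = restrict \<omega> W i" by auto
      ultimately show "f \<omega> = c" using elim by blast
    qed
  qed
qed

lemma pred_decided [measurable]:
  "finite W \<Longrightarrow> Measurable.pred Omega (\<lambda>\<omega>. decided f \<omega> W c)"
  by (rule pred_finite_coordinates) (use decided_cong in blast)+

lemma pred_witness_set:
  assumes [measurable]: "f \<in> measurable Omega (count_space UNIV)" and "finite W"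
  shows "Measurable.pred Omega (\<lambda>\<omega>. witness_set f \<omega> W)"
proof -
  have "witness_set f \<omega> W \<longleftrightarrow> (\<exists>c. f \<omega> = c \<and> decided f \<omega> W c)" for \<omega>
    by (simp add: witness_set_iff_decided)
  moreover note [measurable] = pred_decided[OF assms(2)]
  ultimately show ?thesis by simp
qed

section \<open>The least witness set and the function \<open>Bm m f\<close>\<close>

lemma max_key_le_iff: "finite W \<Longrightarrow> max_key W \<le> m \<longleftrightarrow> W \<subseteq> {..<m}"
  by (cases "W = {}") (auto simp: max_key_def Suc_le_eq)

lemma transp_on_wit_less: "transp_on S wit_less"
proof (rule transp_onI)
  fix U V W assume "wit_less U V" "wit_less V W"
  moreover have "trans (lexord {(a, b). a < (b :: nat)})"
    by (rule lexord_transI) (auto simp: trans_def)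
  ultimately show "wit_less U W"
    unfolding wit_less_def by (elim disjE conjE) (auto dest: transD)
qed

lemma asymp_on_wit_less: "asymp_on S wit_less"
proof (rule asymp_onI)
  fix U V assume "wit_less U V"
  moreover have "asym (lexord {(a, b). a < (b :: nat)})"
    by (rule lexord_asym) (auto simp: asym_on_def)
  ultimately show "\<not> wit_less V U"
    unfolding wit_less_def by (elim disjE conjE) (auto dest: asymD)
qed

lemma totalp_on_wit_less: "S \<subseteq> Collect finite \<Longrightarrow> totalp_on S wit_less"
proof (rule totalp_onI)
  fix V W assume "S \<subseteq> Collect finite" "V \<in> S" "W \<in> S" "V \<noteq> W"
  then have "sorted_list_of_set V \<noteq> sorted_list_of_set W"
    by (metis mem_Collect_eq set_sorted_list_of_set subsetD)
  then have "(sorted_list_of_set V, sorted_list_of_set W) \<in> lexord {(a, b). a < b} \<or>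
    (sorted_list_of_set W, sorted_list_of_set V) \<in> lexord {(a, b). a < b}"
    using lexord_linear[of "{(a, b). a < (b::nat)}" "sorted_list_of_set V" "sorted_list_of_set W"]
      nat_neq_iff by blast
  then show "wit_less V W \<or> wit_less W V"
    unfolding wit_less_def by auto
qed

text \<open>The order compares maxima first, so the least witness set fits into every initial
  segment that is a witness set. The converse is monotonicity.\<close>

lemma least_witness_subset_iff:
  assumes "finite W0" "witness_set f \<omega> W0"
  shows "least_witness f \<omega> \<subseteq> {..<m} \<longleftrightarrow> witness_set f \<omega> {..<m}"
proof -
  \<comment> \<open>A least element exists because only finitely many sets have a key up to that of
    \<open>W0\<close>; a finite set outside \<open>?S\<close> that is a witness set has a larger
    key.\<close>
  let ?S = "{V. V \<subseteq> {..<max_key W0} \<and> witness_set f \<omega> V}"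
  have fin: "finite ?S" by (rule finite_subset[of _ "Pow {..<max_key W0}"]) auto
  have sub: "?S \<subseteq> Collect finite" by (auto intro: finite_subset)
  have "W0 \<in> ?S" using assms max_key_le_iff[of W0 "max_key W0"] by simp
  then obtain L where L: "L \<in> ?S" and Lmin: "\<forall>V\<in>?S. V \<noteq> L \<longrightarrow> wit_less L V"
    using Finite_Set.bex_least_element[OF fin _ transp_on_wit_less
        totalp_on_wit_less[OF sub]] by blast
  have Lfin: "finite L" using L sub by blast
  have less: "wit_less L V" if "finite V" "witness_set f \<omega> V" "V \<noteq> L" for V
  proof (cases "V \<in> ?S")
    case False
    then have "max_key W0 < max_key V" using that max_key_le_iff[of V "max_key W0"] by auto
    moreover have "max_key L \<le> max_key W0" using L Lfin max_key_le_iff by blast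
    ultimately show ?thesis unfolding wit_less_def by simp
  qed (use Lmin that in auto)
  have "least_witness f \<omega> = L"
    unfolding least_witness_def
  proof (rule the_equality)
    fix V assume V: "finite V \<and> witness_set f \<omega> V \<and>
      (\<forall>U. finite U \<and> witness_set f \<omega> U \<and> U \<noteq> V \<longrightarrow> wit_less V U)"
    then show "V = L"
      using less[of V] L Lfin asymp_onD[OF asymp_on_wit_less[of UNIV], of V L] by auto
  qed (use L Lfin less in auto)
  moreover have "L \<subseteq> {..<m}" if "witness_set f \<omega> {..<m}"
  proof -
    have "max_key L \<le> max_key {..<m}" using less[of "{..<m}"] that
      by (cases "L = {..<m}") (auto simp: wit_less_def)
    also have "\<dots> \<le> m" by (simp add: max_key_le_iff)
    finally show ?thesis using Lfin max_key_le_iff by blast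
  qed
  ultimately show ?thesis using L witness_set_mono by blast
qed

lemma AE_Bm_eq:
  assumes "finitary f"
  shows "AE \<omega> in Omega. \<forall>m. Bm m f \<omega> = (if witness_set f \<omega> {..<m} then f \<omega> else -1)"
  using assms[unfolded finitary_def, THEN conjunct2]
  by eventually_elim (auto simp only: Bm_def least_witness_subset_iff)

lemma measurable_Bm:
  assumes "finitary f"
  shows "Bm m f \<in> measurable Omega (count_space UNIV)"
proof -
  define P where "P \<omega> = (\<exists>n. witness_set f \<omega> {..<n})" for \<omega>
  \<comment> \<open>The junk value of \<open>THE\<close> is the same at every point without a finite
    witness set. This yields measurability on the whole space, which almost sure equality in
    \<open>AE_Bm_eq\<close> would not.\<close>
  define R where "R = (THE W :: nat set. False)"
  have f [measurable]: "f \<in> measurable Omega (count_space UNIV)"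
    using assms by (simp add: finitary_def boolean_function_def)
  have [measurable]: "Measurable.pred Omega P"
    unfolding P_def by (intro pred_intros_countable pred_witness_set f) simp
  have [measurable]: "Measurable.pred Omega (\<lambda>\<omega>. witness_set f \<omega> {..<m})"
    by (intro pred_witness_set f) simp
  have "least_witness f \<omega> = R" if "\<not> P \<omega>" for \<omega>
  proof -
    have "\<not> witness_set f \<omega> W" if "finite W" for W
      using \<open>\<not> P \<omega>\<close> max_key_le_iff[OF that, of "max_key W"] witness_set_mono
      unfolding P_def by blast
    then show ?thesis
      unfolding least_witness_def R_def by (intro arg_cong[where f = The]) auto
  qed
  then have "Bm m f = (\<lambda>\<omega>. if P \<omega> then if witness_set f \<omega> {..<m} then f \<omega> else -1
      else if R \<subseteq> {..<m} then f \<omega> else -1)"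
    unfolding Bm_def fun_eq_iff using least_witness_subset_iff[OF finite_lessThan, of f]
    by (smt (verit) P_def)
  then show ?thesis by simp
qed

section \<open>Runs of an algorithm and their measurability\<close>

lemma AE_Omega_imp_AE_pair:
  assumes "AE \<omega> in Omega. P \<omega>"
  shows "AE z in Omega \<Otimes>\<^sub>M Aux. P (fst z)"
proof -
  have "AE \<omega> in distr (Omega \<Otimes>\<^sub>M Aux) Omega fst. P \<omega>"
    unfolding Aux.distr_pair_fst by (rule assms)
  then show ?thesis by (rule AE_distrD[rotated]) simp
qed

lemma finite_queried: "finite (queried nx \<omega> u n)"
  by (simp add: queried_def)

lemma queried_mono: "k \<le> n \<Longrightarrow> queried nx \<omega> u k \<subseteq> queried nx \<omega> u n"
  by (induction rule: dec_induct) (auto simp: queried_def Let_def)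

lemma length_qhist [simp]: "length (qhist nx \<omega> u n) = n"
  by (induction n) (auto simp: Let_def)

lemma qhist_memD: "(i, v) \<in> set (qhist nx \<omega> u n) \<Longrightarrow> v = \<omega> i"
  by (induction n) (auto simp: Let_def)

text \<open>There are countably many histories, so it suffices that the next index is measurable in
  \<open>u\<close> for each fixed history.\<close>

lemma measurable_qhist:
  assumes [measurable]: "\<And>h. (\<lambda>u. nx u h) \<in> measurable Aux (count_space UNIV)"
  shows "(\<lambda>z. qhist nx (fst z) (snd z) n) \<in> measurable (Omega \<Otimes>\<^sub>M Aux) (count_space UNIV)"
proof (induction n)
  case (Suc n)
  have "(\<lambda>z. h @ [(i, fst z i)]) \<in> measurable (Omega \<Otimes>\<^sub>M Aux) (count_space UNIV)"
    for h :: "(nat \<times> int) list" and i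
    by (rule measurable_compose[of "\<lambda>z. fst z i" _ "count_space UNIV" "\<lambda>v. h @ [(i, v)]"]) simp_all
  then have "(\<lambda>z. h @ [(nx (snd z) h, fst z (nx (snd z) h))])
      \<in> measurable (Omega \<Otimes>\<^sub>M Aux) (count_space UNIV)" for h
    by (rule measurable_compose_countable[where f = "\<lambda>i z. h @ [(i, fst z i)]"]) simp
  from measurable_compose_countable[where g = "\<lambda>z. qhist nx (fst z) (snd z) n"
      and f = "\<lambda>h z. h @ [(nx (snd z) h, fst z (nx (snd z) h))]", OF this Suc]
  show ?case by (simp add: Let_def)
qed simp

text \<open>Needed because \<open>measure\<close> is 0 by convention on a nonmeasurable set. The
  number of queries and the history each take countably many values, which reduces everything to
  fixed finite sets.\<close>

lemma pred_mem_alg_W: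
  assumes g: "g \<in> measurable Omega (count_space UNIV)"
    and nx: "\<And>h. (\<lambda>u. nx u h) \<in> measurable Aux (count_space UNIV)"
  shows "Measurable.pred (Omega \<Otimes>\<^sub>M Aux) (\<lambda>z. i \<in> alg_W g nx (fst z) (snd z))"
proof -
  note m [measurable] = measurable_qhist[OF nx]
  have w [measurable]: "Measurable.pred (Omega \<Otimes>\<^sub>M Aux)
      (\<lambda>z. witness_set g (fst z) (queried nx (fst z) (snd z) n))" for n
    unfolding queried_def
  proof (rule measurable_compose_countable[OF _ m,
        where f = "\<lambda>h z. witness_set g (fst z) (fst ` set h)"])
    fix h :: "(nat \<times> int) list"
    show "Measurable.pred (Omega \<Otimes>\<^sub>M Aux) (\<lambda>z. witness_set g (fst z) (fst ` set h))"
      using measurable_compose[OF measurable_fst pred_witness_set[OF g, of "fst ` set h"]] by simp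
  qed
  have "(\<lambda>z. stop_time g nx (fst z) (snd z)) \<in> measurable (Omega \<Otimes>\<^sub>M Aux) (count_space UNIV)"
    unfolding stop_time_def by measurable
  then show ?thesis
    unfolding alg_W_def
  proof (rule measurable_compose_countable[rotated,
        where f = "\<lambda>n z. i \<in> queried nx (fst z) (snd z) n"])
    fix n
    show "Measurable.pred (Omega \<Otimes>\<^sub>M Aux) (\<lambda>z. i \<in> queried nx (fst z) (snd z) n)"
      unfolding queried_def
      by (rule measurable_compose[OF m, of "\<lambda>h. i \<in> fst ` set h"]) simp
  qed
qed

lemma alg_W_subset_queried:
  "witness_set g \<omega> (queried nx \<omega> u n) \<Longrightarrow> alg_W g nx \<omega> u \<subseteq> queried nx \<omega> u n"
  unfolding alg_W_def stop_time_def by (intro queried_mono Least_le)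

lemma witness_set_alg_W:
  "witness_set g \<omega> (queried nx \<omega> u n) \<Longrightarrow> witness_set g \<omega> (alg_W g nx \<omega> u)"
  unfolding alg_W_def stop_time_def by (rule LeastI)

section \<open>Revealment and the fallback strategy\<close>

definition reveal_prob ::
    "((nat \<Rightarrow> int) \<Rightarrow> int) \<Rightarrow> (real \<Rightarrow> (nat \<times> int) list \<Rightarrow> nat) \<Rightarrow> nat \<Rightarrow> real" where
  "reveal_prob g nx i =
     measure (Omega \<Otimes>\<^sub>M Aux) {z \<in> space (Omega \<Otimes>\<^sub>M Aux). i \<in> alg_W g nx (fst z) (snd z)}"

text \<open>The reals are only conditionally complete, so the supremum and infimum in
  \<open>revealment\<close> can be handled only with bounds.\<close>

lemma bdd_above_reveal_prob: "bdd_above (range (reveal_prob g nx))"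
  by (rule bdd_aboveI[of _ 1]) (auto simp: reveal_prob_def)

lemma bdd_below_SUP_reveal_prob: "bdd_below ((\<lambda>nx. SUP i. reveal_prob g nx i) ` S)"
proof (rule bdd_belowI[of _ 0])
  fix y assume "y \<in> (\<lambda>nx. SUP i. reveal_prob g nx i) ` S"
  then obtain nx where "y = (SUP i. reveal_prob g nx i)" by auto
  moreover have "0 \<le> reveal_prob g nx 0" by (simp add: reveal_prob_def)
  ultimately show "0 \<le> y" using cSUP_upper2[OF bdd_above_reveal_prob UNIV_I] by blast
qed

lemma revealment_le:
  assumes "algorithm_for g nx" "\<And>i. reveal_prob g nx i \<le> c"
  shows "revealment g \<le> c"
proof -
  have "(SUP i. reveal_prob g nx i) \<le> c" using assms(2) by (intro cSUP_least) auto
  then show ?thesis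
    unfolding revealment_def reveal_prob_def[symmetric]
    using assms(1) by (intro cINF_lower2[OF bdd_below_SUP_reveal_prob]) auto
qed

text \<open>The algorithm \<open>nx0\<close> makes the infimum range over a nonempty set.\<close>

lemma revealment_approx:
  assumes "algorithm_for g nx0" "0 < \<epsilon>"
  obtains nx where "algorithm_for g nx" "\<And>i. reveal_prob g nx i \<le> revealment g + \<epsilon>"
proof -
  have "(INF nx\<in>{nx. algorithm_for g nx}. SUP i. reveal_prob g nx i) < revealment g + \<epsilon>"
    using assms(2) by (simp add: revealment_def reveal_prob_def)
  then obtain nx where nx: "algorithm_for g nx" "(SUP i. reveal_prob g nx i) < revealment g + \<epsilon>"
    using assms(1) by (subst (asm) cINF_less_iff[OF _ bdd_below_SUP_reveal_prob]) auto
  moreover have "reveal_prob g nx i \<le> (SUP i. reveal_prob g nx i)" for i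
    by (intro cSUP_upper bdd_above_reveal_prob) simp
  ultimately show thesis using that[of nx] by (meson le_less_trans less_imp_le)
qed

text \<open>The fallback that queries everything: repeated forever, it reaches every index, whatever
  was queried before.\<close>

definition first_new :: "(nat \<times> int) list \<Rightarrow> nat" where
  "first_new h = (LEAST i. i \<notin> fst ` set h)"

lemma first_new_covers:
  assumes "\<And>k. t \<le> k \<Longrightarrow> nx u (qhist nx \<omega> u k) = first_new (qhist nx \<omega> u k)"
  shows "{..<n} \<subseteq> queried nx \<omega> u (t + n)"
proof (induction n)
  case (Suc n)
  let ?Q = "queried nx \<omega> u (t + n)"
  have new: "queried nx \<omega> u (t + Suc n) = insert (LEAST i. i \<notin> ?Q) ?Q"
    using assms[of "t + n"] by (simp add: queried_def Let_def first_new_def)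
  have "n \<in> queried nx \<omega> u (t + Suc n)"
  proof (cases "n \<in> ?Q")
    case False
    \<comment> \<open>By induction all indices below \<open>n\<close> are already queried, so the
      least missing one is \<open>n\<close>.\<close>
    then have "(LEAST i. i \<notin> ?Q) = n"
      using Suc by (intro Least_equality) (auto simp: subset_iff not_less[symmetric])
    then show ?thesis using new by simp
  qed (use new in simp)
  then show ?case using Suc new by (auto simp: less_Suc_eq)
qed simp

lemma AE_witness_initial_segment:
  assumes "finitary f"
  shows "AE \<omega> in Omega. \<exists>n. witness_set f \<omega> {..<n}"
  using assms[unfolded finitary_def, THEN conjunct2]
proof eventually_elim
  case (elim \<omega>)
  then obtain W where "finite W" "witness_set f \<omega> W" by auto
  then show ?case using max_key_le_iff[of W "max_key W"] witness_set_mono by blast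
qed

lemma algorithm_for_first_new:
  assumes "finitary f"
  shows "algorithm_for f (\<lambda>_. first_new)"
proof -
  have "AE z in Omega \<Otimes>\<^sub>M Aux. \<exists>n. witness_set f (fst z) {..<n}"
    by (rule AE_Omega_imp_AE_pair) (rule AE_witness_initial_segment[OF assms])
  then have "AE z in Omega \<Otimes>\<^sub>M Aux. \<exists>n. witness_set f (fst z)
      (queried (\<lambda>_. first_new) (fst z) (snd z) n)"
  proof eventually_elim
    case (elim z)
    then obtain n where "witness_set f (fst z) {..<n}" by auto
    moreover have "{..<n} \<subseteq> queried (\<lambda>_. first_new) (fst z) (snd z) (0 + n)"
      by (rule first_new_covers) simp
    ultimately show ?case by (blast intro: witness_set_mono)
  qed
  then show ?thesis by (simp add: algorithm_for_def)
qed

section \<open>From an algorithm for \<open>f\<close> to one for \<open>Bm m f\<close>\<close>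

text \<open>Off a null set, whether \<open>W\<close> is a witness set for \<open>f\<close> is the
  same at any two points agreeing on \<open>W\<close>. If it is, so is \<open>[m]\<close>, and
  \<open>Bm m f\<close> equals \<open>f\<close> at both. If \<open>W = [m]\<close> is not,
  \<open>Bm m f\<close> is -1 at both. The first case serves runs that stay inside
  \<open>[m]\<close>, the second the fallback.\<close>

lemma AE_witness_Bm:
  assumes "finitary f"
  shows "AE \<omega> in Omega. \<forall>m W. finite W \<longrightarrow> W \<subseteq> {..<m} \<longrightarrow> witness_set f \<omega> W \<or> W = {..<m} \<longrightarrow>
    witness_set (Bm m f) \<omega> W"
  using AE_decided_imp_value[of f] AE_Bm_eq[OF assms]
proof eventually_elim
  case (elim \<omega>)
  note Bm = elim(2)
  show ?case
  proof (intro allI impI)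
    fix m W assume W: "finite W" "W \<subseteq> {..<m}" and *: "witness_set f \<omega> W \<or> W = {..<m}"
    show "witness_set (Bm m f) \<omega> W"
      unfolding witness_set_iff_decided[of "Bm m f"] decided_def
      using AE_decided_imp_value[of f] AE_Bm_eq[OF assms]
    proof eventually_elim
      case (elim \<omega>')
      note good = \<open>\<forall>W c. finite W \<longrightarrow> decided f \<omega> W c \<longrightarrow> f \<omega> = c\<close>
        \<open>\<forall>W c. finite W \<longrightarrow> decided f \<omega>' W c \<longrightarrow> f \<omega>' = c\<close>
      show ?case
      proof
        assume agree: "\<forall>i\<in>W. \<omega>' i = \<omega> i"
        have eq: "f \<omega> = f \<omega>' \<and> witness_set f \<omega> W \<and> witness_set f \<omega>' W"
          if "witness_set f \<omega> W \<or> witness_set f \<omega>' W"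
          using that good W(1) decided_cong[OF agree, of f] unfolding witness_set_iff_decided by metis
        show "Bm m f \<omega>' = Bm m f \<omega>"
        proof (cases "witness_set f \<omega> W")
          case True
          then have "witness_set f \<omega> {..<m}" "witness_set f \<omega>' {..<m}" "f \<omega> = f \<omega>'"
            using eq witness_set_mono[OF _ W(2)] by blast+
          then show ?thesis using elim(2) Bm by simp
        next
          case False
          then have "\<not> witness_set f \<omega> {..<m}" "\<not> witness_set f \<omega>' {..<m}" using * eq by blast+
          then show ?thesis using elim(2) Bm by simp
        qed
      qed
    qed
  qed
qed

lemma algorithm_Bm_of_algorithm:
  assumes f: "finitary f" and A: "algorithm_for f nx" and "0 < \<epsilon>"
  shows "\<forall>\<^sub>F m in sequentially. \<exists>nx'. algorithm_for (Bm m f) nx' \<and>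
    (\<forall>i. reveal_prob (Bm m f) nx' i \<le> reveal_prob f nx i + \<epsilon>)"
proof -
  let ?M = "Omega \<Otimes>\<^sub>M Aux"
  have fm: "f \<in> measurable Omega (count_space UNIV)"
    using f by (simp add: finitary_def boolean_function_def)
  have nx: "(\<lambda>u. nx u h) \<in> measurable Aux (count_space UNIV)" for h
    using A by (simp add: algorithm_for_def)
  note [measurable] = pred_mem_alg_W[OF fm nx]
  define bad where "bad m = {z \<in> space ?M. \<exists>i. i \<in> alg_W f nx (fst z) (snd z) \<and> m \<le> i}" for m
  have bad [measurable]: "bad m \<in> sets ?M" for m
    unfolding bad_def by measurable
  have "(\<lambda>m. measure ?M (bad m)) \<longlonglongrightarrow> measure ?M (\<Inter>m. bad m)"
    by (rule OA.finite_Lim_measure_decseq) (auto simp: decseq_def bad_def intro: order_trans)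
  \<comment> \<open>The set of queried bits is finite at every point, even where
    \<open>stop_time\<close> is a junk value.\<close>
  moreover have "(\<Inter>m. bad m) = {}"
  proof -
    have "z \<notin> bad (Suc (Max (alg_W f nx (fst z) (snd z))))" for z
      using Max_ge[of "alg_W f nx (fst z) (snd z)"]
      by (force simp: bad_def alg_W_def finite_queried not_less_eq_eq[symmetric])
    then show ?thesis by blast
  qed
  ultimately have "\<forall>\<^sub>F m in sequentially. measure ?M (bad m) < \<epsilon>"
    using \<open>0 < \<epsilon>\<close> by (simp add: order_tendstoD)
  then show ?thesis
  proof eventually_elim
    case (elim m)
    define nx' where "nx' u h = (if fst ` set h \<subseteq> {..<m} then nx u h else first_new h)" for u h
    have late: "nx' u h = first_new h" if "\<not> fst ` set h \<subseteq> {..<m}" for u h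
      using that by (simp only: nx'_def if_False)
    \<comment> \<open>Either containment suffices. Hence, if the run of \<open>nx\<close> leaves
      \<open>[m]\<close> within \<open>n\<close> queries, so does that of \<open>nx'\<close>, which
      from then on uses the fallback.\<close>
    have same: "qhist nx' \<omega> u n = qhist nx \<omega> u n"
      if "queried nx \<omega> u n \<subseteq> {..<m} \<or> queried nx' \<omega> u n \<subseteq> {..<m}" for \<omega> u n
      using that
    proof (induction n)
      case (Suc n)
      then have sub: "queried nx \<omega> u n \<subseteq> {..<m} \<or> queried nx' \<omega> u n \<subseteq> {..<m}"
        using queried_mono[of n "Suc n"] by (meson le_SucI order_refl order_trans)
      then have "qhist nx' \<omega> u n = qhist nx \<omega> u n" by (rule Suc.IH)
      moreover from this sub have "nx' u (qhist nx \<omega> u n) = nx u (qhist nx \<omega> u n)"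
        unfolding queried_def by (simp add: nx'_def)
      ultimately show ?case by simp
    qed simp
    have main: "AE z in ?M. (\<exists>n. witness_set (Bm m f) (fst z) (queried nx' (fst z) (snd z) n)) \<and>
        (z \<notin> bad m \<longrightarrow> alg_W (Bm m f) nx' (fst z) (snd z) \<subseteq> alg_W f nx (fst z) (snd z))"
      using A[unfolded algorithm_for_def, THEN conjunct2] AE_Omega_imp_AE_pair[OF AE_witness_Bm[OF f]]
    proof eventually_elim
      case (elim z)
      obtain \<omega> u where z: "z = (\<omega>, u)" by (cases z)
      define s where "s = stop_time f nx \<omega> u"
      have Ws: "alg_W f nx \<omega> u = queried nx \<omega> u s" by (simp add: alg_W_def s_def)
      have wit: "witness_set f \<omega> (queried nx \<omega> u s)"
        using elim(1) witness_set_alg_W[of f \<omega> nx u] by (auto simp: z Ws)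
      show ?case
      proof (cases "queried nx \<omega> u s \<subseteq> {..<m}")
        case True
        then have eq: "queried nx' \<omega> u s = queried nx \<omega> u s" using same[of \<omega> u s] by (simp add: queried_def)
        then have "witness_set (Bm m f) \<omega> (queried nx' \<omega> u s)"
          using elim(2) True wit finite_queried by (simp add: z)
        moreover from this have "alg_W (Bm m f) nx' \<omega> u \<subseteq> alg_W f nx \<omega> u"
          unfolding Ws eq[symmetric] by (rule alg_W_subset_queried)
        ultimately show ?thesis unfolding z fst_conv snd_conv by blast
      next
        case False
        then have "\<not> queried nx' \<omega> u s \<subseteq> {..<m}" using same[of \<omega> u s] unfolding queried_def by metis
        then have "nx' u (qhist nx' \<omega> u k) = first_new (qhist nx' \<omega> u k)" if "s \<le> k" for k
          using queried_mono[OF that, of nx' \<omega> u] by (intro late) (auto simp: queried_def)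
        then have "{..<m} \<subseteq> queried nx' \<omega> u (s + m)" by (rule first_new_covers)
        moreover have "witness_set (Bm m f) \<omega> {..<m}"
          using elim(2) unfolding z fst_conv by blast
        ultimately have "witness_set (Bm m f) \<omega> (queried nx' \<omega> u (s + m))"
          using witness_set_mono by blast
        moreover have "z \<in> bad m"
          using False by (auto simp: bad_def z Ws space_pair_measure not_less)
        ultimately show ?thesis unfolding z fst_conv snd_conv by blast
      qed
    qed
    have "(\<lambda>u. nx' u h) \<in> measurable Aux (count_space UNIV)" for h
      unfolding nx'_def using nx by simp
    then have "algorithm_for (Bm m f) nx'"
      unfolding algorithm_for_def using main by auto
    moreover have "reveal_prob (Bm m f) nx' i \<le> reveal_prob f nx i + \<epsilon>" for i
    proof -
      let ?R = "{z \<in> space ?M. i \<in> alg_W f nx (fst z) (snd z)}"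
      have "reveal_prob (Bm m f) nx' i \<le> measure ?M (?R \<union> bad m)"
        unfolding reveal_prob_def
      proof (rule OA.finite_measure_mono_AE)
        show "AE z in ?M. z \<in> {z \<in> space ?M. i \<in> alg_W (Bm m f) nx' (fst z) (snd z)} \<longrightarrow>
          z \<in> ?R \<union> bad m"
          using main by eventually_elim auto
      qed measurable
      also have "\<dots> \<le> measure ?M ?R + measure ?M (bad m)"
        by (rule measure_Un_le) measurable
      also have "\<dots> \<le> reveal_prob f nx i + \<epsilon>" using elim by (simp add: reveal_prob_def)
      finally show ?thesis .
    qed
    ultimately show ?case by blast
  qed
qed

section \<open>Windows that certify that an initial segment is a witness set\<close>

text \<open>The first \<open>n\<close> bits are overwritten and only bits below \<open>k\<close> are
  read, so this is an event of the window \<open>{n..<k}\<close> alone. Extensional patterns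
  \<open>x\<close> keep the quantifier finite.\<close>

definition robust :: "((nat \<Rightarrow> int) \<Rightarrow> int) \<Rightarrow> nat \<Rightarrow> nat \<Rightarrow> (nat \<Rightarrow> int) \<Rightarrow> bool" where
  "robust f n k \<omega> \<longleftrightarrow>
     (\<forall>x\<in>PiE {..<n} (\<lambda>_. {-1, 1}). \<exists>c. decided f (overwrite n x \<omega>) {..<k} c)"

lemma robust_cong:
  assumes "\<forall>i\<in>{n..<k}. \<omega> i = \<omega>' i"
  shows "robust f n k \<omega> \<longleftrightarrow> robust f n k \<omega>'"
proof -
  have "decided f (overwrite n x \<omega>) {..<k} c \<longleftrightarrow> decided f (overwrite n x \<omega>') {..<k} c" for x c
    using assms by (intro decided_cong) (auto simp: overwrite_def)
  then show ?thesis by (simp add: robust_def)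
qed

lemma pred_robust [measurable]: "Measurable.pred Omega (robust f n k)"
  by (rule pred_finite_coordinates[of "{n..<k}"]) (use robust_cong in blast)+

lemma robust_mono: "robust f n k \<omega> \<Longrightarrow> k \<le> l \<Longrightarrow> robust f n l \<omega>"
  unfolding robust_def by (meson decided_mono lessThan_subset_iff)

text \<open>For a fixed pattern, overwriting preserves the almost sure existence of a deciding
  initial segment. There are finitely many patterns, so a common length exists.\<close>

lemma AE_ex_robust:
  assumes "finitary f"
  shows "AE \<omega> in Omega. \<exists>k. robust f n k \<omega>"
proof -
  let ?X = "PiE {..<n} (\<lambda>_. {-1, 1 :: int})"
  have fin: "finite ?X" by (intro finite_PiE) auto
  have "AE \<omega> in Omega. \<exists>k c. decided f \<omega> {..<k} c"
    using AE_witness_initial_segment[OF assms]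
    by eventually_elim (auto simp: witness_set_iff_decided)
  then have "AE \<omega> in Omega. \<exists>k c. decided f (overwrite n x \<omega>) {..<k} c" if "x \<in> ?X" for x
    using that by (intro AE_overwrite[where P = "\<lambda>\<omega>. \<exists>k c. decided f \<omega> {..<k} c"])
      (auto simp: PiE_iff)
  then have "AE \<omega> in Omega. \<forall>x\<in>?X. \<exists>k c. decided f (overwrite n x \<omega>) {..<k} c"
    using fin by (intro AE_finite_allI) auto
  then show ?thesis
  proof eventually_elim
    case (elim \<omega>)
    then obtain K where K: "\<forall>x\<in>?X. \<exists>c. decided f (overwrite n x \<omega>) {..<K x} c" by metis
    have "K x \<le> (\<Sum>x\<in>?X. K x)" if "x \<in> ?X" for x
      using that fin by (intro member_le_sum) auto
    then have "robust f n (\<Sum>x\<in>?X. K x) \<omega>"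
      unfolding robust_def using K by (meson decided_mono lessThan_subset_iff)
    then show ?case ..
  qed
qed

text \<open>Continuity from above for the decreasing failure events. Requiring \<open>k > n\<close>
  lets the windows advance when this is iterated.\<close>

lemma ex_robust_prob:
  assumes "finitary f" "0 < \<epsilon>"
  shows "\<exists>k>n. measure Omega {\<omega> \<in> space Omega. \<not> robust f n k \<omega>} < \<epsilon>"
proof -
  define B where "B k = {\<omega> \<in> space Omega. \<not> robust f n k \<omega>}" for k
  have [measurable]: "B k \<in> sets Omega" for k unfolding B_def by measurable
  have "(\<lambda>k. measure Omega (B k)) \<longlonglongrightarrow> measure Omega (\<Inter>k. B k)"
    by (rule Omega.finite_Lim_measure_decseq) (auto simp: decseq_def, auto simp: B_def robust_mono)
  moreover have "measure Omega (\<Inter>k. B k) = 0"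
  proof -
    have "AE \<omega> in Omega. \<omega> \<notin> (\<Inter>k. B k)"
      using AE_ex_robust[OF assms(1), of n] by eventually_elim (auto simp: B_def)
    then show ?thesis by (subst Omega.prob_eq_0) measurable
  qed
  ultimately have "\<forall>\<^sub>F k in sequentially. measure Omega (B k) < \<epsilon>"
    using assms(2) by (simp add: order_tendstoD)
  then have "\<forall>\<^sub>F k in sequentially. n < k \<and> measure Omega (B k) < \<epsilon>"
    using eventually_gt_at_top by (rule eventually_conj[rotated])
  then obtain k where "n < k" "measure Omega (B k) < \<epsilon>"
    unfolding eventually_sequentially by blast
  then show ?thesis unfolding B_def by blast
qed

text \<open>A point \<open>\<omega>'\<close> agreeing with \<open>\<omega>\<close> on
  \<open>W\<close> has the same window, and its own first \<open>n\<close> bits are one of the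
  patterns in \<open>robust\<close>. So \<open>[k]\<close>, hence \<open>[m]\<close>, is a witness
  set for \<open>f\<close> at \<open>\<omega>'\<close>, where therefore \<open>Bm m f\<close> and
  \<open>f\<close> coincide.\<close>

lemma AE_witness_of_witness_Bm:
  assumes "finitary f"
  shows "AE \<omega> in Omega. \<forall>n k m W. finite W \<longrightarrow> {n..<k} \<subseteq> W \<longrightarrow> k \<le> m \<longrightarrow> robust f n k \<omega> \<longrightarrow>
    witness_set (Bm m f) \<omega> W \<longrightarrow> witness_set f \<omega> W"
  using AE_decided_imp_value[of f]
proof eventually_elim
  case (elim \<omega>)
  show ?case
  proof (intro allI impI)
    fix n k m W
    assume W: "finite W" "{n..<k} \<subseteq> W" and km: "k \<le> m" and rob: "robust f n k \<omega>"
      and wit: "witness_set (Bm m f) \<omega> W"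
    \<comment> \<open>The decided value is first found as \<open>Bm m f \<omega>\<close>; outside
      the null set it must then be \<open>f \<omega>\<close>.\<close>
    have "decided f \<omega> W (Bm m f \<omega>)"
      unfolding decided_def
      using AE_decided_imp_value[of f] AE_Bm_eq[OF assms] AE_Omega_sign
        wit[unfolded witness_set_iff_decided decided_def]
    proof eventually_elim
      case (elim \<omega>')
      show ?case
      proof
        assume agree: "\<forall>i\<in>W. \<omega>' i = \<omega> i"
        have "restrict \<omega>' {..<n} \<in> PiE {..<n} (\<lambda>_. {-1, 1})" using elim(3) by auto
        then obtain c where "decided f (overwrite n (restrict \<omega>' {..<n}) \<omega>) {..<k} c"
          using rob unfolding robust_def by blast
        moreover have "\<forall>i\<in>{..<k}. overwrite n (restrict \<omega>' {..<n}) \<omega> i = \<omega>' i"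
          using agree W(2) by (auto simp: overwrite_def subset_iff)
        ultimately have "decided f \<omega>' {..<k} c" using decided_cong by blast
        then have "witness_set f \<omega>' {..<k}"
          using elim(1) unfolding witness_set_iff_decided by auto
        then have "witness_set f \<omega>' {..<m}"
          using km by (auto intro: witness_set_mono)
        then show "f \<omega>' = Bm m f \<omega>" using elim(2,4) agree by simp
      qed
    qed
    then show "witness_set f \<omega> W"
      using elim W(1) unfolding witness_set_iff_decided by metis
  qed
qed

section \<open>Running an algorithm after querying a window\<close>

text \<open>Only bits that were queried may be read off; the value \<open>0\<close> elsewhere is junk.\<close>
definition bits_of :: "(nat \<times> int) list \<Rightarrow> nat \<Rightarrow> int" where
  "bits_of h i = (case map_of h i of Some v \<Rightarrow> v | None \<Rightarrow> 0)"

lemma bits_of_qhist: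
  assumes "i \<in> queried nx \<omega> u n"
  shows "bits_of (qhist nx \<omega> u n) i = \<omega> i"
proof -
  from assms obtain v where "map_of (qhist nx \<omega> u n) i = Some v"
    unfolding queried_def by (metis map_of_eq_None_iff not_None_eq)
  then show ?thesis using qhist_memD map_of_SomeD by (fastforce simp: bits_of_def)
qed

text \<open>Dropping the first \<open>b - a\<close> entries shows \<open>nx\<close> exactly the
  history of its own run. It may query window bits again, which does not change the set of queried
  bits.\<close>

definition window_alg ::
    "((nat \<Rightarrow> int) \<Rightarrow> bool) \<Rightarrow> nat \<Rightarrow> nat \<Rightarrow> ((nat \<times> int) list \<Rightarrow> nat) \<Rightarrow> (nat \<times> int) list \<Rightarrow> nat" where
  "window_alg G a b nx h =
     (if length h < b - a then a + length h
      else if G (bits_of h) then nx (drop (b - a) h) else first_new h)"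

context
  fixes G :: "(nat \<Rightarrow> int) \<Rightarrow> bool" and a b :: nat and u :: real and nx nx'
  assumes G: "\<And>\<omega> \<omega>'. \<forall>i\<in>{a..<b}. \<omega> i = \<omega>' i \<Longrightarrow> G \<omega> = G \<omega>'"
    and nx': "nx' u = window_alg G a b (nx u)"
begin

lemma queried_window:
  assumes "n \<le> b - a"
  shows "queried nx' \<omega> u n = {a..<a + n}"
  using assms
proof (induction n)
  case (Suc n)
  then have "queried nx' \<omega> u (Suc n) = insert (a + n) (queried nx' \<omega> u n)"
    by (simp add: queried_def Let_def nx' window_alg_def)
  then show ?case using Suc by auto
qed (simp add: queried_def)

lemma G_bits_of_qhist:
  assumes "b - a \<le> k"
  shows "G (bits_of (qhist nx' \<omega> u k)) \<longleftrightarrow> G \<omega>"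
proof -
  have "{a..<b} \<subseteq> queried nx' \<omega> u k"
    using queried_mono[OF assms, of nx' \<omega> u] queried_window[of "b - a" \<omega>] by auto
  then show ?thesis by (intro G ballI bits_of_qhist) auto
qed

lemma qhist_after_window:
  assumes "G \<omega>"
  shows "qhist nx' \<omega> u (b - a + n) = qhist nx' \<omega> u (b - a) @ qhist nx \<omega> u n"
proof (induction n)
  case (Suc n)
  have "nx' u (qhist nx' \<omega> u (b - a + n)) = nx u (qhist nx \<omega> u n)"
    using assms G_bits_of_qhist[of "b - a + n" \<omega>] Suc by (simp add: nx' window_alg_def)
  then show ?case using Suc by (simp add: Let_def)
qed simp

lemma queried_after_window:
  assumes "G \<omega>"
  shows "queried nx' \<omega> u (b - a + n) = {a..<b} \<union> queried nx \<omega> u n"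
  using queried_window[of "b - a" \<omega>] unfolding queried_def qhist_after_window[OF assms]
  by (auto simp: image_Un)

lemma first_new_after_window:
  assumes "\<not> G \<omega>" "b - a \<le> k"
  shows "nx' u (qhist nx' \<omega> u k) = first_new (qhist nx' \<omega> u k)"
  using assms G_bits_of_qhist[of k \<omega>] by (simp add: nx' window_alg_def)

end

section \<open>Choosing a window at random\<close>

text \<open>The ceiling minus one, rather than the floor, sends \<open>u = 1\<close> to
  \<open>K - 1\<close>; \<open>nat\<close> truncates the value -1 at \<open>u = 0\<close> to 0. So
  all of the unit interval maps below \<open>K\<close>.\<close>

definition selector :: "nat \<Rightarrow> real \<Rightarrow> nat" where
  "selector K u = nat (\<lceil>real K * u\<rceil> - 1)"

lemma measurable_selector [measurable]: "selector K \<in> measurable Aux (count_space UNIV)"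
  unfolding selector_def by measurable

lemma selector_less:
  assumes "0 < K" "u \<in> {0..1}"
  shows "selector K u < K"
proof -
  have "real K * u \<le> real K" using assms mult_left_le[of u "real K"] by simp
  then have "\<lceil>real K * u\<rceil> \<le> int K" by (simp add: ceiling_le_iff)
  then show ?thesis using assms(1) by (simp add: selector_def)
qed

lemma selector_bounds:
  assumes "0 < K" "u \<in> {0..1}"
  shows "u \<in> {real (selector K u) / real K .. (real (selector K u) + 1) / real K}"
proof -
  have "real (selector K u) = max 0 (real_of_int \<lceil>real K * u\<rceil> - 1)"
    by (cases "1 \<le> \<lceil>real K * u\<rceil>") (auto simp: selector_def max_def)
  moreover have "0 \<le> real K * u" using assms by simp
  ultimately have "real (selector K u) \<le> real K * u" "real K * u \<le> real (selector K u) + 1"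
    using ceiling_correct[of "real K * u"] by linarith+
  then show ?thesis using assms(1) by (simp add: field_simps)
qed

lemma measure_Aux_interval_le:
  assumes "x \<le> y"
  shows "measure Aux {x..y} \<le> y - x"
proof -
  have "measure Aux {x..y} = measure lborel ({0..1} \<inter> {x..y})"
    unfolding Aux_def by (subst measure_uniform_measure) auto
  also have "\<dots> \<le> measure lborel {x..y}"
    by (rule measure_mono_fmeasurable) (auto simp flip: box_real cbox_interval)
  finally show ?thesis using assms by simp
qed

lemma measure_pair_snd:
  assumes "B \<in> sets Aux"
  shows "measure (Omega \<Otimes>\<^sub>M Aux) (UNIV \<times> B) = measure Aux B"
proof -
  have "emeasure (Omega \<Otimes>\<^sub>M Aux) (space Omega \<times> B) = emeasure Aux B"
    by (subst Aux.emeasure_pair_measure_Times[OF sets.top assms])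
      (simp only: Omega.emeasure_space_1 mult_1)
  then show ?thesis by (simp add: measure_def)
qed

lemma AE_pair_unit_interval: "AE z in Omega \<Otimes>\<^sub>M Aux. snd z \<in> {0..1}"
proof (rule OA.AE_pair_measure)
  show "AE \<omega> in Omega. AE u in Aux. snd (\<omega>, u) \<in> {0..1}"
    unfolding Aux_def by (intro AE_I2 AE_uniform_measureI) auto
qed measurable

text \<open>Distinct values of the selector give disjoint blocks, so a bit lies in the chosen block for
  a single value of the selector only.\<close>
lemma random_block_cover:
  assumes "strict_mono N" "0 < K"
  obtains T where "T \<in> sets (Omega \<Otimes>\<^sub>M Aux)" "measure (Omega \<Otimes>\<^sub>M Aux) T \<le> 1 / real K"
    "\<And>z. snd z \<in> {0..1} \<Longrightarrow> i \<in> {N (selector K (snd z))..<N (Suc (selector K (snd z)))} \<Longrightarrow> z \<in> T"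
proof (cases "\<exists>j. i \<in> {N j..<N (Suc j)}")
  case False
  then show thesis using that[of "{}"] by auto
next
  case True
  then obtain j where j: "N j \<le> i" "i < N (Suc j)" by auto
  \<comment> \<open>All \<open>u\<close> in the unit interval with selector value \<open>j\<close>
    lie here. For \<open>j \<ge> K\<close> there are none, but the bound by the length remains
    valid.\<close>
  let ?I = "{real j / real K .. (real j + 1) / real K}"
  have uniq: "l = j" if "N l \<le> i" "i < N (Suc l)" for l
  proof -
    have "N l < N (Suc j)" "N j < N (Suc l)" using that j by auto
    then show ?thesis using strict_mono_less[OF assms(1)] by force
  qed
  show thesis
  proof (rule that)
    show "UNIV \<times> ?I \<in> sets (Omega \<Otimes>\<^sub>M Aux)"
      using pair_measureI[OF sets.top, of ?I Aux Omega] unfolding space_Omega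
      by (simp only: sets_Aux atLeastAtMost_borel)
    have "measure (Omega \<Otimes>\<^sub>M Aux) (UNIV \<times> ?I) = measure Aux ?I"
      by (rule measure_pair_snd) (simp add: sets_Aux)
    also have "\<dots> \<le> (real j + 1) / real K - real j / real K"
      by (rule measure_Aux_interval_le) (simp add: divide_right_mono)
    also have "\<dots> = 1 / real K" by (simp flip: diff_divide_distrib)
    finally show "measure (Omega \<Otimes>\<^sub>M Aux) (UNIV \<times> ?I) \<le> 1 / real K" .
  next
    fix z :: "(nat \<Rightarrow> int) \<times> real"
    assume "snd z \<in> {0..1}" "i \<in> {N (selector K (snd z))..<N (Suc (selector K (snd z)))}"
    then show "z \<in> UNIV \<times> ?I"
      using selector_bounds[OF assms(2), of "snd z"] uniq[of "selector K (snd z)"]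
      by (cases z) auto
  qed
qed

section \<open>From an algorithm for \<open>Bm m f\<close> to one for \<open>f\<close>\<close>

text \<open>The threshold for \<open>m\<close> is uniform in \<open>nx\<close>, so that a nearly
  optimal \<open>nx\<close> may be chosen depending on \<open>m\<close>.\<close>

lemma algorithm_of_algorithm_Bm:
  assumes f: "finitary f" and "0 < \<epsilon>"
  shows "\<forall>\<^sub>F m in sequentially. \<forall>nx. algorithm_for (Bm m f) nx \<longrightarrow>
    (\<exists>nx'. algorithm_for f nx' \<and> (\<forall>i. reveal_prob f nx' i \<le> reveal_prob (Bm m f) nx i + \<epsilon>))"
proof -
  let ?M = "Omega \<Otimes>\<^sub>M Aux"
  \<comment> \<open>Half of \<open>\<epsilon>\<close> pays for querying the random window, at most
    \<open>1 / K\<close> per bit; the other half, shared among \<open>K\<close> windows, pays for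
    windows that fail.\<close>
  obtain K :: nat where K: "0 < K" "1 / real K < \<epsilon> / 2"
    using reals_Archimedean[of "\<epsilon> / 2"] \<open>0 < \<epsilon>\<close>
    by (metis inverse_eq_divide zero_less_Suc half_gt_zero)
  have "0 < \<epsilon> / (2 * real K)" using \<open>0 < \<epsilon>\<close> K(1) by simp
  then have "\<forall>n. \<exists>k. n < k \<and>
      measure Omega {\<omega> \<in> space Omega. \<not> robust f n k \<omega>} < \<epsilon> / (2 * real K)"
    using ex_robust_prob[OF f] by blast
  from choice[OF this] obtain nxt where nxt: "\<And>n. n < nxt n"
    "\<And>n. measure Omega {\<omega> \<in> space Omega. \<not> robust f n (nxt n) \<omega>} < \<epsilon> / (2 * real K)"
    by blast
  define N where "N j = (nxt ^^ j) 0" for j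
  have N: "strict_mono N" unfolding strict_mono_Suc_iff N_def using nxt(1) by simp
  define rob where "rob j = robust f (N j) (N (Suc j))" for j
  have rob_cong: "\<forall>i\<in>{N j..<N (Suc j)}. \<omega> i = \<omega>' i \<Longrightarrow> rob j \<omega> = rob j \<omega>'" for j \<omega> \<omega>'
    unfolding rob_def by (rule robust_cong)
  have [measurable]: "Measurable.pred Omega (rob j)" for j unfolding rob_def by measurable
  define E where "E j = {\<omega> \<in> space Omega. \<not> rob j \<omega>}" for j
  have E [measurable]: "E j \<in> sets Omega" for j unfolding E_def by measurable
  \<comment> \<open>The event that any of the \<open>K\<close> windows fails, chosen or not, so that
    it does not involve \<open>u\<close>.\<close>
  define bad where "bad = (\<Union>j<K. E j) \<times> space Aux"
  have bad_sets [measurable]: "bad \<in> sets ?M" unfolding bad_def by measurable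
  have UN_E: "(\<Union>j<K. E j) \<in> sets Omega" by measurable
  have "measure ?M bad = measure Omega (\<Union>j<K. E j)"
    unfolding bad_def measure_def Aux.emeasure_pair_measure_Times[OF UN_E sets.top]
    by (simp only: Aux.emeasure_space_1 mult_1_right)
  also have "\<dots> \<le> (\<Sum>j<K. measure Omega (E j))"
    using E by (intro Omega.finite_measure_subadditive_finite) auto
  also have "\<dots> \<le> (\<Sum>j<K. \<epsilon> / (2 * real K))"
    using nxt(2) by (intro sum_mono less_imp_le) (simp add: E_def rob_def N_def)
  also have "\<dots> = \<epsilon> / 2" using K(1) by simp
  finally have bad: "measure ?M bad \<le> \<epsilon> / 2" .
  \<comment> \<open>From \<open>N K\<close> on, all \<open>K\<close> windows lie inside
    \<open>[m]\<close>.\<close>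
  show ?thesis
    using eventually_ge_at_top[of "N K"]
  proof eventually_elim
    case (elim m)
    show ?case
    proof (intro allI impI)
      fix nx assume A: "algorithm_for (Bm m f) nx"
      then have nx: "(\<lambda>u. nx u h) \<in> measurable Aux (count_space UNIV)" for h
        by (simp add: algorithm_for_def)
      note [measurable] = pred_mem_alg_W[OF measurable_Bm[OF f, of m] nx]
      define block where "block u = {N (selector K u)..<N (Suc (selector K u))}" for u
      \<comment> \<open>The choice of the block and the algorithm for \<open>Bm m f\<close> share the randomness \<open>u\<close>: the
        union bound below needs no independence.\<close>
      define nx' where "nx' u = (let j = selector K u in
        window_alg (rob j) (N j) (N (Suc j)) (nx u))" for u
      have main: "AE z in ?M. (\<exists>n. witness_set f (fst z) (queried nx' (fst z) (snd z) n)) \<and>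
          (z \<notin> bad \<longrightarrow> alg_W f nx' (fst z) (snd z) \<subseteq>
            block (snd z) \<union> alg_W (Bm m f) nx (fst z) (snd z))"
        using A[unfolded algorithm_for_def, THEN conjunct2] AE_pair_unit_interval
          AE_Omega_imp_AE_pair[OF AE_witness_of_witness_Bm[OF f]]
          AE_Omega_imp_AE_pair[OF AE_witness_initial_segment[OF f]]
      proof eventually_elim
        case (elim z)
        obtain \<omega> u where z: "z = (\<omega>, u)" by (cases z)
        define j where "j = selector K u"
        have j: "j < K" using selector_less[OF K(1)] elim(2) by (simp add: j_def z)
        have nx'_u: "nx' u = window_alg (rob j) (N j) (N (Suc j)) (nx u)"
          by (simp add: nx'_def j_def Let_def)
        let ?L = "N (Suc j) - N j"
        show ?case
        proof (cases "rob j \<omega>")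
          case True
          define s where "s = stop_time (Bm m f) nx \<omega> u"
          have Ws: "alg_W (Bm m f) nx \<omega> u = queried nx \<omega> u s" by (simp add: alg_W_def s_def)
          have Q: "queried nx' \<omega> u (?L + s) = block u \<union> queried nx \<omega> u s"
            unfolding block_def j_def[symmetric]
            by (rule queried_after_window[where nx = nx and nx' = nx' and G = "rob j"])
              (fact rob_cong nx'_u True)+
          have "N (Suc j) \<le> m"
            using strict_mono_less_eq[OF N, of "Suc j" K] j \<open>N K \<le> m\<close> by simp
          moreover have "witness_set (Bm m f) \<omega> (queried nx \<omega> u s)"
            using elim(1) witness_set_alg_W[of "Bm m f" \<omega> nx u] by (auto simp: z Ws)
          then have "witness_set (Bm m f) \<omega> (queried nx' \<omega> u (?L + s))"
            unfolding Q by (rule witness_set_mono) simp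
          moreover have "{N j..<N (Suc j)} \<subseteq> queried nx' \<omega> u (?L + s)"
            unfolding Q block_def j_def[symmetric] by simp
          ultimately have "witness_set f \<omega> (queried nx' \<omega> u (?L + s))"
            using elim(3) True finite_queried unfolding z fst_conv rob_def by blast
          moreover from this have "alg_W f nx' \<omega> u \<subseteq> block u \<union> alg_W (Bm m f) nx \<omega> u"
            unfolding Ws Q[symmetric] by (rule alg_W_subset_queried)
          ultimately show ?thesis unfolding z fst_conv snd_conv by blast
        next
          case False
          \<comment> \<open>After a failed window the fallback still finds a witness set almost
            surely, and its queries are charged to \<open>bad\<close>.\<close>
          from elim(4) obtain n where "witness_set f \<omega> {..<n}" by (auto simp: z)
          moreover have "{..<n} \<subseteq> queried nx' \<omega> u (?L + n)"
          proof (rule first_new_covers)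
            show "nx' u (qhist nx' \<omega> u k) = first_new (qhist nx' \<omega> u k)" if "?L \<le> k" for k
              by (rule first_new_after_window[where nx = nx and nx' = nx' and G = "rob j"])
                (fact rob_cong nx'_u False that)+
          qed
          ultimately have "witness_set f \<omega> (queried nx' \<omega> u (?L + n))"
            by (rule witness_set_mono)
          moreover have "z \<in> bad" using False j by (auto simp: bad_def E_def z)
          ultimately show ?thesis unfolding z fst_conv snd_conv by blast
        qed
      qed
      have "(\<lambda>u. nx' u h) \<in> measurable Aux (count_space UNIV)" for h
        unfolding nx'_def Let_def
      proof (rule measurable_compose_countable[OF _ measurable_selector,
            where f = "\<lambda>j u. window_alg (rob j) (N j) (N (Suc j)) (nx u) h"])
        show "(\<lambda>u. window_alg (rob j) (N j) (N (Suc j)) (nx u) h)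
          \<in> measurable Aux (count_space UNIV)" for j
          unfolding window_alg_def using nx by simp
      qed
      then have "algorithm_for f nx'"
        unfolding algorithm_for_def using main by auto
      moreover have "reveal_prob f nx' i \<le> reveal_prob (Bm m f) nx i + \<epsilon>" for i
      proof -
        let ?R = "{z \<in> space ?M. i \<in> alg_W (Bm m f) nx (fst z) (snd z)}"
        obtain T where T [measurable]: "T \<in> sets ?M" and "measure ?M T \<le> 1 / real K"
          and cover: "\<And>z. snd z \<in> {0..1} \<Longrightarrow> i \<in> block (snd z) \<Longrightarrow> z \<in> T"
          using random_block_cover[OF N K(1), of i] unfolding block_def by metis
        have "reveal_prob f nx' i \<le> measure ?M (?R \<union> (T \<union> bad))"
          unfolding reveal_prob_def
        proof (rule OA.finite_measure_mono_AE)
          show "AE z in ?M. z \<in> {z \<in> space ?M. i \<in> alg_W f nx' (fst z) (snd z)} \<longrightarrow>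
            z \<in> ?R \<union> (T \<union> bad)"
            using main AE_pair_unit_interval by eventually_elim (use cover in blast)
        qed measurable
        also have "\<dots> \<le> measure ?M ?R + measure ?M (T \<union> bad)"
          by (rule measure_Un_le) measurable
        also have "measure ?M (T \<union> bad) \<le> measure ?M T + measure ?M bad"
          by (rule measure_Un_le) measurable
        finally show ?thesis
          using \<open>measure ?M T \<le> 1 / real K\<close> K(2) bad by (simp add: reveal_prob_def)
      qed
      ultimately show "\<exists>nx'. algorithm_for f nx' \<and>
        (\<forall>i. reveal_prob f nx' i \<le> reveal_prob (Bm m f) nx i + \<epsilon>)" by blast
    qed
  qed
qed

theorem mainTheorem18:
  assumes "finitary f"
  shows "(\<lambda>m. revealment (Bm m f)) \<longlonglongrightarrow> revealment f"
proof (rule tendstoI)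
  fix \<epsilon> :: real assume "0 < \<epsilon>"
  then have e: "0 < \<epsilon> / 3" by simp
  \<comment> \<open>Fixed before \<open>m\<close>, because the threshold in
    \<open>algorithm_Bm_of_algorithm\<close> depends on it.\<close>
  obtain nx where nx: "algorithm_for f nx" "\<And>i. reveal_prob f nx i \<le> revealment f + \<epsilon> / 3"
    using revealment_approx[OF algorithm_for_first_new[OF assms] e] by blast
  show "\<forall>\<^sub>F m in sequentially. dist (revealment (Bm m f)) (revealment f) < \<epsilon>"
    using algorithm_Bm_of_algorithm[OF assms nx(1) e] algorithm_of_algorithm_Bm[OF assms e]
  proof eventually_elim
    case (elim m)
    then obtain nx' where nx': "algorithm_for (Bm m f) nx'"
      "\<And>i. reveal_prob (Bm m f) nx' i \<le> reveal_prob f nx i + \<epsilon> / 3" by blast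
    have "reveal_prob (Bm m f) nx' i \<le> revealment f + \<epsilon> / 3 + \<epsilon> / 3" for i
      using nx(2)[of i] nx'(2)[of i] by linarith
    then have upper: "revealment (Bm m f) \<le> revealment f + \<epsilon> / 3 + \<epsilon> / 3"
      by (rule revealment_le[OF nx'(1)])
    \<comment> \<open>This choice depends on \<open>m\<close>, which the uniform threshold permits;
      \<open>nx'\<close> shows that algorithms for \<open>Bm m f\<close> exist.\<close>
    obtain nb where nb: "algorithm_for (Bm m f) nb"
      "\<And>i. reveal_prob (Bm m f) nb i \<le> revealment (Bm m f) + \<epsilon> / 3"
      using revealment_approx[OF nx'(1) e] by blast
    with elim(2) obtain na where na: "algorithm_for f na"
      "\<And>i. reveal_prob f na i \<le> reveal_prob (Bm m f) nb i + \<epsilon> / 3" by blast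
    have "reveal_prob f na i \<le> revealment (Bm m f) + \<epsilon> / 3 + \<epsilon> / 3" for i
      using nb(2)[of i] na(2)[of i] by linarith
    then have "revealment f \<le> revealment (Bm m f) + \<epsilon> / 3 + \<epsilon> / 3"
      by (rule revealment_le[OF na(1)])
    with upper \<open>0 < \<epsilon>\<close> show ?case by (simp add: dist_real_def abs_if field_simps)
  qed
qed

end
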